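(* Let $\bar{x}\in\Omega$ be a highly robust weakly efficient solution of $(P_{\mathcal{U}})$. Suppose there exists a scalar $L>0$ such that $\mathcal{A}_L(x)\cap\mathcal{U}_i\neq\emptyset$ for each $x\in\Omega$ and each $i\in I$, where $$\mathcal{A}_L(x):=\{x^*\in X^*:\ \langle x^*,x-\bar{x}\rangle=L\Vert x-\bar{x}\Vert\}.$$ Then $\bar{x}$ is an isolated efficient solution of the problem $\min f(x)$ s.t. $x\in\Omega$ with constant $L$.
   Context: Setting: $X$ is a real Banach space with dual $X^*$ and pairing $\langle\cdot,\cdot\rangle$; $p\ge 2$, $I=\{1,\dots,p\}$; $f=(f_1,\dots,f_p):X\to\mathbb{R}^p$; $\Omega\subseteq X$ is nonempty (the robust feasible set); $\mathcal{U}_i\subseteq X^*$, $i\in I$, are nonempty and $\mathcal{U}=\prod_{i=1}^p\mathcal{U}_i$. For $u\in\mathcal{U}$ put $f_i(x,u_i)=f_i(x)-\langle u_i,x\rangle$ and $f(x,u)=(f_1(x,u_1),\dots,f_p(x,u_p))$. $(P_u)$ is the problem of minimizing $f(x,u)$ over $x\in\Omega$, and $(P_{\mathcal{U}})$ is the family $(P_u)_{u\in\mathcal{U}}$. For $a,b\in\mathbb{R}^p$, $a<b$ iff $a_i<b_i$ for all $i\in I$. $\bar x\in\Omega$ is a highly robust weakly efficient solution of $(P_{\mathcal{U}})$ if for every $u\in\mathcal{U}$ there is no $x\in\Omega$ with $f(x,u)<f(\bar x,u)$. $\bar x\in\Omega$ is an isolated efficient solution of $\min f(x)$ s.t. $x\in\Omega$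 with constant $L>0$ if $\max_{i\in I}\{f_i(x)-f_i(\bar x)\}\ge L\Vert x-\bar x\Vert$ for all $x\in\Omega$. *)

theory Defs
  imports "HOL-Analysis.Analysis"
begin

text \<open>Strict componentwise order. The library order \<open><\<close> on \<open>real ^ 'p\<close> is a different
  relation: there \<open>a < b\<close> means \<open>a \<le> b \<and> a \<noteq> b\<close>.\<close>

definition vec_less :: "real ^ 'p \<Rightarrow> real ^ 'p \<Rightarrow> bool" where
  "vec_less a b \<longleftrightarrow> (\<forall>i. a $ i < b $ i)"

definition perturbed ::
    "('a::real_normed_vector \<Rightarrow> real ^ 'p) \<Rightarrow> 'a \<Rightarrow> ('p \<Rightarrow> 'a \<Rightarrow>\<^sub>L real) \<Rightarrow> real ^ 'p" where
  "perturbed f x u = (\<chi> i. f x $ i - blinfun_apply (u i) x)"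

definition weakly_efficient :: "('a \<Rightarrow> real ^ 'p) \<Rightarrow> 'a set \<Rightarrow> 'a \<Rightarrow> bool" where
  "weakly_efficient g \<Omega> xb \<longleftrightarrow> xb \<in> \<Omega> \<and> \<not> (\<exists>x\<in>\<Omega>. vec_less (g x) (g xb))"

definition highly_robust_weakly_efficient ::
    "('a::real_normed_vector \<Rightarrow> real ^ 'p) \<Rightarrow> 'a set \<Rightarrow> ('p \<Rightarrow> ('a \<Rightarrow>\<^sub>L real) set) \<Rightarrow> 'a \<Rightarrow> bool" where
  "highly_robust_weakly_efficient f \<Omega> \<U> xb \<longleftrightarrow>
     xb \<in> \<Omega> \<and> (\<forall>u \<in> Pi UNIV \<U>. weakly_efficient (\<lambda>x. perturbed f x u) \<Omega> xb)"

definition isolated_efficient ::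
    "('a::real_normed_vector \<Rightarrow> real ^ 'p) \<Rightarrow> 'a set \<Rightarrow> real \<Rightarrow> 'a \<Rightarrow> bool" where
  "isolated_efficient f \<Omega> L xb \<longleftrightarrow>
     xb \<in> \<Omega> \<and> L > 0 \<and>
     (\<forall>x\<in>\<Omega>. (MAX i. f x $ i - f xb $ i) \<ge> L * norm (x - xb))"

definition \<A> :: "real \<Rightarrow> 'a::real_normed_vector \<Rightarrow> 'a \<Rightarrow> ('a \<Rightarrow>\<^sub>L real) set" where
  "\<A> L xb x = {xs. blinfun_apply xs (x - xb) = L * norm (x - xb)}"

end

theory Submission
  imports Defs
begin

text \<open>Fix a feasible \<open>x\<close>. The perturbation may be chosen after \<open>x\<close>, so in every component \<open>i\<close> one
  can pick \<open>u i\<close> from \<open>\<A> L xb x \<inter> \<U> i\<close>. By linearity, perturbing by this \<open>u\<close> lowers each difference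
  \<open>f x $ i - f xb $ i\<close> by exactly \<open>L * norm (x - xb)\<close>. As \<open>x\<close> does not strictly dominate \<open>xb\<close> in the
  problem perturbed by \<open>u\<close>, at least one of the lowered differences is nonnegative, and this bounds
  the maximum of the original ones from below.\<close>


theorem theorem8:
  fixes f :: "'a::banach \<Rightarrow> real ^ 'p"
    and \<Omega> :: "'a set"
    and \<U> :: "'p \<Rightarrow> ('a \<Rightarrow>\<^sub>L real) set"
    and xb :: 'a
    and L :: real
  assumes "CARD('p) \<ge> 2"
    and "\<Omega> \<noteq> {}"
    and "\<And>i. \<U> i \<noteq> {}"
    and "highly_robust_weakly_efficient f \<Omega> \<U> xb"
    and "L > 0"
    and "\<And>x i. x \<in> \<Omega> \<Longrightarrow> \<A> L xb x \<inter> \<U> i \<noteq> {}"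
  shows "isolated_efficient f \<Omega> L xb"
  unfolding isolated_efficient_def
proof (intro conjI ballI)
  show "xb \<in> \<Omega>"
    using assms(4) by (simp add: highly_robust_weakly_efficient_def)
  show "L > 0" by fact
  fix x assume x: "x \<in> \<Omega>"
  have "\<forall>i. \<exists>v. v \<in> \<A> L xb x \<and> v \<in> \<U> i"
    using assms(6)[OF x] by blast
  then obtain u where uA: "\<And>i. u i \<in> \<A> L xb x" and uU: "\<And>i. u i \<in> \<U> i"
    by metis
  have shift: "blinfun_apply (u i) x - blinfun_apply (u i) xb = L * norm (x - xb)" for i
    using uA[of i] by (simp add: \<A>_def blinfun.diff_right)
  have "weakly_efficient (\<lambda>y. perturbed f y u) \<Omega> xb"
    using assms(4) uU by (auto simp: highly_robust_weakly_efficient_def)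
  then obtain i where "perturbed f x u $ i \<ge> perturbed f xb u $ i"
    using x by (auto simp: weakly_efficient_def vec_less_def not_less)
  then have "L * norm (x - xb) \<le> f x $ i - f xb $ i"
    using shift[of i] by (simp add: perturbed_def)
  also have "\<dots> \<le> (MAX i. f x $ i - f xb $ i)"
    by (intro Max_ge) auto
  finally show "(MAX i. f x $ i - f xb $ i) \<ge> L * norm (x - xb)" .
qed

end
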